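(* Let $E=(\mathbb{G}_a^d,\phi)$ be a $d$-dimensional $t$-module defined over a global function field $L$. Let $P_1,\dots,P_\ell\in\mathrm{Mat}_{d\times 1}(L)$ and let $$\mathcal{R}=\{(a_1,\dots,a_\ell)\in\mathbb{F}_q[t]^{\oplus\ell}\mid \phi_{a_1}(P_1)+\cdots+\phi_{a_\ell}(P_\ell)=0\}.$$ Define $$\mathrm{Sol}_\phi(P_1,\dots,P_\ell):=\Big\{(\bm{x},a_1,\dots,a_\ell)\in\mathrm{Mat}_{d\times 1}(L[t])\times\mathbb{F}_q[t]^{\oplus\ell}\;\Big|\;(\phi_t-t)\bm{x}=\sum_{i=1}^\ell a_iP_i\Big\}.$$ If $P_1,\dots,P_\ell$ are $\mathbb{F}_q$-linearly independent, then the map $$\mathrm{Sol}_\phi(P_1,\dots,P_\ell)\to\mathcal{R},\qquad(\bm{x},a_1,\dots,a_\ell)\mapsto(a_1,\dots,a_\ell)$$ is a well-defined $\mathbb{F}_q[t]$-module isomorphism.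
   Context: $\mathbb{F}_q$ is a finite field with $q$ elements, $K=\mathbb{F}_q(\theta)$, and $\mathbb{C}_\infty$ is the completion of an algebraic closure of $\mathbb{F}_q(\!(1/\theta)\!)$. A global function field $L$ here means a finite extension of $K$ with $L\subset\mathbb{C}_\infty$. $L[t,\tau]$ is the twisted polynomial ring in two variables with $\alpha t=t\alpha$, $t\tau=\tau t$, $\tau\alpha=\alpha^q\tau$ for $\alpha\in L$; $L[\tau]\subset L[t,\tau]$ is the subring of elements not involving $t$. For $f=\sum_i c_it^i\in L[t]$ put $f^{(n)}=\sum_i c_i^{q^n}t^i$, extended entrywise to matrices. A matrix $A=\sum_iA_i\tau^i\in\mathrm{Mat}_{d\times d}(L[t,\tau])$ with $A_i\in\mathrm{Mat}_{d\times d}(L[t])$ acts $\mathbb{F}_q[t]$-linearly on $\mathrm{Mat}_{d\times 1}(L[t])$ by $A\bm{v}=\sum_iA_i\bm{v}^{(i)}$. In particular $(\phi_t-t)\bm{x}=\phi_t\bm{x}-t\bm{x}$. A $d$-dimensional $t$-module defined over $L$ ($d>0$) is a pair $E=(\mathbb{G}_a^d,\phi)$, where $\phi:\mathbb{F}_q[t]\to\mathrm{Mat}_{d\times d}(L[\tau])$, $a\mapsto\phi_a$, is an $\mathbb{F}_q$-algebra homomorphism such that $\partial\phi_t-\theta\,\mathrm{Id}_d$ is nilpotent; here $\partial\phi_t\in\mathrm{Mat}_{d\times d}(L)$ is the $\tau^0$-coefficient of $\phi_t$. $\phi_a(P)$ denotes the action of $\phi_a$ on $P\in\mathrm{Mat}_{d\times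 1}(L)$, i.e. if $\phi_a=\sum_iC_i\tau^i$ with $C_i\in\mathrm{Mat}_{d\times d}(L)$, then $\phi_a(P)=\sum_iC_iP^{(i)}$, where $P^{(i)}$ is obtained from $P$ by raising each entry to the $q^i$-th power. $\mathbb{F}_q[t]$ acts on $\mathrm{Mat}_{d\times 1}(L[t])\times\mathbb{F}_q[t]^{\oplus\ell}$ and on $\mathbb{F}_q[t]^{\oplus \ell}$ by ordinary multiplication, which gives the module structures on $\mathrm{Sol}_\phi(P_1,\dots,P_\ell)$ and $\mathcal{R}$. *)

theory Defs
  imports
    "HOL-Algebra.Algebraic_Closure_Type"
    "HOL-Computational_Algebra.Formal_Laurent_Series"
    "HOL-Library.Product_Plus"
    "HOL-Analysis.Analysis"
begin

no_notation fps_nth (infixl \<open>$\<close> 75)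

section \<open>The field \<open>\<complex>\<^sub>\<infinity>\<close> and global function fields\<close>

text \<open>
  The type \<open>'fq\<close> is the finite field with \<open>q = CARD('fq)\<close> elements. The formal variable of
  \<open>'fq fls\<close> is the uniformizer \<open>1/\<theta>\<close>, so that \<open>\<theta>\<close> is \<open>fls_X_inv\<close>. The field \<open>'c\<close> together with
  the embedding \<open>\<iota>\<close> is a completion of the algebraic closure of \<open>'fq fls\<close>: the metric of \<open>'c\<close> comes
  from a multiplicative absolute value \<open>\<lambda>x. dist x 0\<close> extending the one on Laurent series, and the
  image of \<open>\<iota>\<close> is dense. Completeness is part of the sort of \<open>'c\<close>.
\<close>

definition C_infty :: "('fq::{field,finite} fls alg_closure \<Rightarrow> 'c::{field,complete_space}) \<Rightarrow> bool"
  where "C_infty \<iota> \<longleftrightarrow>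
    \<iota> 1 = 1 \<and> (\<forall>x y. \<iota> (x + y) = \<iota> x + \<iota> y) \<and> (\<forall>x y. \<iota> (x * y) = \<iota> x * \<iota> y) \<and>
    (\<forall>x y::'c. dist x y = dist (x - y) 0) \<and>
    (\<forall>x y::'c. dist (x * y) 0 = dist x 0 * dist y 0) \<and>
    (\<forall>f. f \<noteq> 0 \<longrightarrow> dist (\<iota> (to_ac f)) 0 = real CARD('fq) powi (- fls_subdegree f)) \<and>
    closure (range \<iota>) = UNIV"

definition Fq_emb :: "('fq::{field,finite} fls alg_closure \<Rightarrow> 'c::field) \<Rightarrow> 'fq \<Rightarrow> 'c"
  where "Fq_emb \<iota> c = \<iota> (to_ac (fls_const c))"

definition theta :: "('fq::{field,finite} fls alg_closure \<Rightarrow> 'c::field) \<Rightarrow> 'c"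
  where "theta \<iota> = \<iota> (to_ac fls_X_inv)"

definition rational_field :: "('fq::{field,finite} fls alg_closure \<Rightarrow> 'c::field) \<Rightarrow> 'c set"
  where "rational_field \<iota> =
    {poly (map_poly (Fq_emb \<iota>) f) (theta \<iota>) / poly (map_poly (Fq_emb \<iota>) g) (theta \<iota>) | f g. g \<noteq> 0}"

definition global_function_field ::
  "('fq::{field,finite} fls alg_closure \<Rightarrow> 'c::field) \<Rightarrow> 'c set \<Rightarrow> bool"
  where "global_function_field \<iota> L \<longleftrightarrow>
    rational_field \<iota> \<subseteq> L \<and>
    (\<forall>x\<in>L. \<forall>y\<in>L. x - y \<in> L \<and> x * y \<in> L) \<and> (\<forall>x\<in>L. inverse x \<in> L) \<and>
    (\<exists>B. finite B \<and> B \<subseteq> L \<and>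
      (\<forall>x\<in>L. \<exists>k. (\<forall>b\<in>B. k b \<in> rational_field \<iota>) \<and> x = (\<Sum>b\<in>B. k b * b)))"


section \<open>Twisted polynomials\<close>

text \<open>
  An element \<open>\<Sum>i. c\<^sub>i \<tau>\<^sup>i\<close> of \<open>L[\<tau>]\<close> is encoded by the polynomial with coefficients \<open>c\<^sub>i\<close> (of type
  \<open>'c poly\<close>), and an element \<open>\<Sum>i. f\<^sub>i \<tau>\<^sup>i\<close> of \<open>L[t,\<tau>]\<close>, with \<open>f\<^sub>i \<in> L[t]\<close>, by the polynomial with
  coefficients \<open>f\<^sub>i\<close> (of type \<open>'c poly poly\<close>; the outer variable is \<open>\<tau>\<close>). Only the additive structure
  of these types is that of the twisted rings: their commutative type class multiplication is not the
  twisted one, which on \<open>L[\<tau>]\<close> is \<open>tau_mult\<close>.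
\<close>

definition polys_over :: "'c::zero set \<Rightarrow> 'c poly set"
  where "polys_over L = {f. \<forall>n. coeff f n \<in> L}"

definition tau_mult :: "nat \<Rightarrow> 'c::comm_semiring_1 poly \<Rightarrow> 'c poly \<Rightarrow> 'c poly"
  where "tau_mult q f g =
    (\<Sum>i\<le>degree f. \<Sum>j\<le>degree g. monom (coeff f i * coeff g j ^ (q ^ i)) (i + j))"

definition tau_mat_mult ::
  "nat \<Rightarrow> 'c::comm_semiring_1 poly ^ 'd::finite ^ 'd \<Rightarrow> 'c poly ^ 'd ^ 'd \<Rightarrow> 'c poly ^ 'd ^ 'd"
  where "tau_mat_mult q A B = (\<chi> i k. \<Sum>j\<in>UNIV. tau_mult q (A $ i $ j) (B $ j $ k))"

text \<open>The inclusion of matrices over \<open>L[\<tau>]\<close> into matrices over \<open>L[t,\<tau>]\<close>.\<close>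

definition tau_incl :: "'c::zero poly ^ 'd ^ 'd \<Rightarrow> 'c poly poly ^ 'd ^ 'd"
  where "tau_incl A = (\<chi> i j. map_poly (\<lambda>c. [:c:]) (A $ i $ j))"

definition twist :: "nat \<Rightarrow> nat \<Rightarrow> 'c::comm_semiring_1 poly \<Rightarrow> 'c poly"
  where "twist q n f = map_poly (\<lambda>c. c ^ (q ^ n)) f"

definition tau_act ::
  "nat \<Rightarrow> 'c::comm_semiring_1 poly poly ^ 'd::finite ^ 'd \<Rightarrow> 'c poly ^ 'd \<Rightarrow> 'c poly ^ 'd"
  where "tau_act q A v =
    (\<chi> i. \<Sum>j\<in>UNIV. \<Sum>n\<le>degree (A $ i $ j). coeff (A $ i $ j) n * twist q n (v $ j))"

text \<open>The action of a matrix over \<open>L[\<tau>]\<close> on a column vector over \<open>L\<close>.\<close>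

definition point_act ::
  "nat \<Rightarrow> 'c::comm_semiring_1 poly ^ 'd::finite ^ 'd \<Rightarrow> 'c ^ 'd \<Rightarrow> 'c ^ 'd"
  where "point_act q C P =
    (\<chi> i. \<Sum>j\<in>UNIV. \<Sum>n\<le>degree (C $ i $ j). coeff (C $ i $ j) n * (P $ j) ^ (q ^ n))"


section \<open>t-modules\<close>

definition nilpotent_matrix :: "'c::semiring_1 ^ 'd::finite ^ 'd \<Rightarrow> bool"
  where "nilpotent_matrix N \<longleftrightarrow> (\<exists>m. ((\<lambda>M. N ** M) ^^ m) (mat 1) = 0)"

definition tau_const :: "'c::zero poly ^ 'd ^ 'd \<Rightarrow> 'c ^ 'd ^ 'd"
  where "tau_const A = (\<chi> i j. coeff (A $ i $ j) 0)"

text \<open>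
  \<open>t_module \<iota> L \<phi>\<close>: \<open>\<phi>\<close> is a t-module of dimension \<open>CARD('d)\<close> defined over \<open>L\<close>. The variable of
  \<open>'fq poly\<close> is \<open>t\<close>.
\<close>

definition t_module ::
  "('fq::{field,finite} fls alg_closure \<Rightarrow> 'c::field) \<Rightarrow> 'c set \<Rightarrow>
   ('fq poly \<Rightarrow> 'c poly ^ 'd::finite ^ 'd) \<Rightarrow> bool"
  where "t_module \<iota> L \<phi> \<longleftrightarrow>
    (\<forall>a i j. \<phi> a $ i $ j \<in> polys_over L) \<and>
    \<phi> 1 = mat 1 \<and>
    (\<forall>a b. \<phi> (a + b) = \<phi> a + \<phi> b) \<and>
    (\<forall>a b. \<phi> (a * b) = tau_mat_mult CARD('fq) (\<phi> a) (\<phi> b)) \<and>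
    (\<forall>c a. \<phi> (smult c a) = (\<chi> i j. smult (Fq_emb \<iota> c) (\<phi> a $ i $ j))) \<and>
    nilpotent_matrix (tau_const (\<phi> [:0, 1:]) - mat (theta \<iota>))"


section \<open>Relations and solutions\<close>

text \<open>
  A family \<open>P\<^sub>1, \<dots>, P\<^sub>\<ell>\<close> is a function on a finite index type \<open>'l\<close> with \<open>\<ell> = CARD('l)\<close>; accordingly
  \<open>\<bbbF>\<^sub>q[t]\<^sup>\<oplus>\<^sup>\<ell>\<close> is \<open>'fq poly ^ 'l\<close>.
\<close>

definition Fq_lin_indep ::
  "('fq::{field,finite} fls alg_closure \<Rightarrow> 'c::field) \<Rightarrow> ('l::finite \<Rightarrow> 'c ^ 'd) \<Rightarrow> bool"
  where "Fq_lin_indep \<iota> P \<longleftrightarrow>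
    (\<forall>c. (\<Sum>i\<in>UNIV. Fq_emb \<iota> (c i) *s P i) = 0 \<longrightarrow> (\<forall>i. c i = 0))"

definition relation_module ::
  "('fq::{field,finite} poly \<Rightarrow> 'c::field poly ^ 'd::finite ^ 'd) \<Rightarrow> ('l::finite \<Rightarrow> 'c ^ 'd) \<Rightarrow>
   ('fq poly ^ 'l) set"
  where "relation_module \<phi> P =
    {a. (\<Sum>i\<in>UNIV. point_act CARD('fq) (\<phi> (a $ i)) (P i)) = 0}"

text \<open>\<open>mat [:[:0, 1:]:]\<close> is \<open>t Id\<^sub>d\<close> over \<open>L[t,\<tau>]\<close>, and \<open>\<chi> j. [:P i $ j:]\<close> is \<open>P\<^sub>i\<close> as a vector over \<open>L[t]\<close>.\<close>

definition Sol ::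
  "('fq::{field,finite} fls alg_closure \<Rightarrow> 'c::field) \<Rightarrow> 'c set \<Rightarrow>
   ('fq poly \<Rightarrow> 'c poly ^ 'd::finite ^ 'd) \<Rightarrow> ('l::finite \<Rightarrow> 'c ^ 'd) \<Rightarrow>
   (('c poly ^ 'd) \<times> ('fq poly ^ 'l)) set"
  where "Sol \<iota> L \<phi> P =
    {(x, a). (\<forall>j. x $ j \<in> polys_over L) \<and>
      tau_act CARD('fq) (tau_incl (\<phi> [:0, 1:]) - mat [:[:0, 1:]:]) x =
        (\<Sum>i\<in>UNIV. map_poly (Fq_emb \<iota>) (a $ i) *s (\<chi> j. [:P i $ j:]))}"

text \<open>Scalar multiplication of \<open>\<bbbF>\<^sub>q[t]\<close> on \<open>Mat\<^sub>d\<^sub>\<times>\<^sub>1(L[t]) \<times> \<bbbF>\<^sub>q[t]\<^sup>\<oplus>\<^sup>\<ell>\<close>.\<close>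

definition pair_scale ::
  "('fq::{field,finite} fls alg_closure \<Rightarrow> 'c::field) \<Rightarrow> 'fq poly \<Rightarrow>
   ('c poly ^ 'd) \<times> ('fq poly ^ 'l) \<Rightarrow> ('c poly ^ 'd) \<times> ('fq poly ^ 'l)"
  where "pair_scale \<iota> b z = (map_poly (Fq_emb \<iota>) b *s fst z, b *s snd z)"

definition module_iso_on ::
  "('r::comm_ring_1 \<Rightarrow> 'a::ab_group_add \<Rightarrow> 'a) \<Rightarrow> ('r \<Rightarrow> 'b::ab_group_add \<Rightarrow> 'b) \<Rightarrow>
   'a set \<Rightarrow> 'b set \<Rightarrow> ('a \<Rightarrow> 'b) \<Rightarrow> bool"
  where "module_iso_on s1 s2 M N f \<longleftrightarrow>
    Modules.module s1 \<and> Modules.module s2 \<and>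
    module.subspace s1 M \<and> module.subspace s2 N \<and>
    (\<forall>x\<in>M. \<forall>y\<in>M. f (x + y) = f x + f y) \<and>
    (\<forall>r. \<forall>x\<in>M. f (s1 r x) = s2 r (f x)) \<and>
    f \<in> M \<rightarrow> N \<and> bij_betw f M N"

end

theory Submission
  imports Defs
begin

text \<open>
  Write \<open>x = \<Sum>n. x\<^sub>n t\<^sup>n\<close> with \<open>x\<^sub>n \<in> L\<^sup>d\<close>, let \<open>T\<close> be the action of \<open>\<phi>\<^sub>t\<close> on \<open>L\<^sup>d\<close>, and let \<open>p\<^sub>n\<close> be
  the coefficient of \<open>t\<^sup>n\<close> in \<open>\<Sum>i. a\<^sub>i P\<^sub>i\<close>. Comparing coefficients, \<open>(\<phi>\<^sub>t - t) x = \<Sum>i. a\<^sub>i P\<^sub>i\<close> says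
  \<open>T x\<^sub>0 = p\<^sub>0\<close> and \<open>T x\<^bsub>n+1\<^esub> - x\<^sub>n = p\<^bsub>n+1\<^esub>\<close> for all \<open>n\<close> (lemma \<open>Sol_iff\<close>). The second family of equations
  is a recursion that runs backwards in \<open>n\<close>; since \<open>x\<^sub>n = 0\<close> for large \<open>n\<close>, it has exactly one
  solution, whatever the \<open>a\<^sub>i\<close> are. So the projection \<open>(x, a) \<mapsto> a\<close> is injective, and \<open>a\<close> lies in
  its image if and only if the remaining equation \<open>T x\<^sub>0 = p\<^sub>0\<close> holds for that solution.

  To recognise this last condition, apply \<open>T\<^sup>n\<close> to the \<open>n\<close>-th equation and add up: the sum
  telescopes, and \<open>\<Sum>n. T\<^sup>n p\<^sub>n = p\<^sub>0 - T x\<^sub>0\<close> (lemma \<open>telescoping_sum\<close>). Since \<open>\<phi>\<close> is a homomorphism,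
  \<open>\<phi>\<^sub>a(P) = \<Sum>n. T\<^sup>n (c\<^sub>n P)\<close> for \<open>a = \<Sum>n. c\<^sub>n t\<^sup>n\<close> (lemma \<open>point_act_eq_sum\<close>), so the left-hand side is
  \<open>\<Sum>i. \<phi>\<^bsub>a\<^sub>i\<^esub>(P\<^sub>i)\<close>. Hence the condition is \<open>a \<in> \<R>\<close>, and the image of the projection is \<open>\<R>\<close>.

  All this rests on the map \<open>x \<mapsto> x\<^sup>q\<close> being additive and fixing \<open>\<bbbF>\<^sub>q\<close>: additivity passes to \<open>T\<close> and
  makes products of twisted polynomials act by composition, and the two properties together make
  \<open>x \<mapsto> (\<phi>\<^sub>t - t) x\<close> linear over \<open>\<bbbF>\<^sub>q[t]\<close>.
\<close>

section \<open>Coefficientwise homomorphisms and the Frobenius power map\<close>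

lemma map_poly_add_hom:
  fixes h :: "'a::comm_semiring_1 \<Rightarrow> 'b::comm_semiring_1"
  assumes "h 0 = 0" "\<And>x y. h (x + y) = h x + h y"
  shows "map_poly h (f + g) = map_poly h f + map_poly h g"
  by (intro poly_eqI) (simp add: coeff_map_poly assms)

lemma map_poly_mult_hom:
  fixes h :: "'a::comm_semiring_1 \<Rightarrow> 'b::comm_semiring_1"
  assumes "h 0 = 0" "\<And>x y. h (x + y) = h x + h y" "\<And>x y. h (x * y) = h x * h y"
  shows "map_poly h (f * g) = map_poly h f * map_poly h g"
proof -
  have h_sum: "h (sum u A) = (\<Sum>x\<in>A. h (u x))" for u :: "nat \<Rightarrow> 'a" and A
    by (induction A rule: infinite_finite_induct) (simp_all add: assms)
  show ?thesis
    by (intro poly_eqI) (simp add: coeff_map_poly coeff_mult assms h_sum)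
qed

text \<open>Multiplication by a nonzero element permutes the nonzero elements, so it does not change
  their product.\<close>

lemma power_card_eq_self:
  fixes x :: "'fq::{field,finite}"
  shows "x ^ CARD('fq) = x"
proof (cases "x = 0")
  case False
  have "x * (\<Prod>y\<in>UNIV-{0}. x * y) = (x * x ^ (CARD('fq) - 1)) * \<Prod>(UNIV-{0})"
    by (simp add: prod.distrib card_Diff_singleton mult.assoc)
  also have "x * x ^ (CARD('fq) - 1) = x ^ Suc (CARD('fq) - 1)"
    by (rule power_Suc[symmetric])
  also have "Suc (CARD('fq) - 1) = CARD('fq)"
    by (rule Suc_diff_1) (rule zero_less_card_finite)
  also have "(\<Prod>y\<in>UNIV-{0}. x * y) = (\<Prod>y\<in>UNIV-{0}. y)"
    by (rule prod.reindex_bij_witness[of _ "\<lambda>y. y / x" "\<lambda>y. x * y"]) (use False in auto)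
  finally show ?thesis
    by simp
qed simp

lemma card_field_gt_1: "CARD('fq::{field,finite}) > 1"
proof -
  have "card {0, 1 :: 'fq} \<le> CARD('fq)"
    by (rule card_mono) auto
  then show ?thesis by simp
qed

locale finite_field_embedding =
  fixes e :: "'fq::{field,finite} \<Rightarrow> 'c::field"
  assumes e_one: "e 1 = 1"
    and e_add: "e (x + y) = e x + e y"
    and e_mult: "e (x * y) = e x * e y"
begin

lemma e_zero [simp]: "e 0 = 0"
  using e_add[of 0 0] by (metis add_0 add_cancel_left_left)

lemma e_diff: "e (x - y) = e x - e y"
  using e_add[of "x - y" y] by (simp add: algebra_simps)

lemma inj_e: "inj e"
proof (rule injI)
  fix x y assume "e x = e y"
  then have "e ((x - y) * inverse (x - y)) = 0"
    by (simp only: e_mult e_diff) simp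
  then show "x = y"
    using e_one by (cases "x = y") auto
qed

lemma e_power: "e (x ^ n) = e x ^ n"
  by (induction n) (simp_all add: e_one e_mult)

lemma e_power_card: "e c ^ (CARD('fq) ^ n) = e c"
  by (induction n)
    (simp_all add: power_mult e_power[symmetric] power_card_eq_self)

text \<open>Both sides are monic polynomials of degree \<open>q\<close> in \<open>x\<close> that vanish at the \<open>q\<close> elements of \<open>\<bbbF>\<^sub>q\<close>.\<close>

lemma power_card_minus_self_eq_prod:
  "x ^ CARD('fq) - x = (\<Prod>c\<in>UNIV. x - e c)"
proof -
  let ?q = "CARD('fq)"
  let ?F = "monom 1 ?q - [:0, 1:] :: 'c poly" and ?G = "\<Prod>c\<in>UNIV. [:- e c, 1:]"
  have deg_G: "degree ?G = ?q"
    by (subst degree_prod_eq_sum_degree) auto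
  have "?F = ?G"
  proof (rule poly_eqI_degree_lead_coeff[where n = ?q and A = "range e"])
    have "lead_coeff ?G = 1"
      by (simp add: lead_coeff_prod)
    then show "coeff ?F ?q = coeff ?G ?q"
      using card_field_gt_1[where 'fq = 'fq]
      by (simp add: deg_G coeff_pCons split: nat.splits)
    show "degree ?F \<le> ?q"
      using card_field_gt_1[where 'fq = 'fq]
      by (intro degree_diff_le) (simp_all add: degree_monom_le)
    show "poly ?F z = poly ?G z" if "z \<in> range e" for z
    proof -
      obtain c where c: "z = e c" using \<open>z \<in> range e\<close> by blast
      have "poly ?F z = 0"
        using e_power_card[of c 1] by (simp add: c poly_monom)
      moreover have "poly ?G z = 0"
        by (auto simp: c poly_prod)
      ultimately show ?thesis by simp
    qed
  qed (simp_all add: deg_G card_image inj_e)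
  then have "poly ?F x = poly ?G x" by simp
  then show ?thesis by (simp add: poly_monom poly_prod)
qed

text \<open>
  Let \<open>F = X\<^sup>q - X\<close>. By the factorization above, \<open>F\<close> is invariant under translation by \<open>\<bbbF>\<^sub>q\<close>.
  Therefore \<open>F(X + y)\<close> and \<open>F(X) + F(y)\<close>, both monic of degree \<open>q\<close>, agree at the \<open>q\<close> elements of
  \<open>\<bbbF>\<^sub>q\<close>, so they are equal. Thus \<open>F\<close> is additive, and so is \<open>X\<^sup>q = F + X\<close>.
\<close>

lemma frobenius_add: "(x + y :: 'c) ^ CARD('fq) = x ^ CARD('fq) + y ^ CARD('fq)"
proof -
  let ?q = "CARD('fq)"
  define F where "F = (monom 1 ?q - [:0, 1:] :: 'c poly)"
  have poly_F: "poly F z = z ^ ?q - z" for z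
    by (simp add: F_def poly_monom)
  have deg_F: "degree F = ?q" and lead_F: "coeff F ?q = 1"
  proof -
    show "coeff F ?q = 1"
      using card_field_gt_1[where 'fq = 'fq] by (simp add: F_def coeff_pCons split: nat.splits)
    moreover have "degree F \<le> ?q"
      unfolding F_def using card_field_gt_1[where 'fq = 'fq]
      by (intro degree_diff_le) (simp_all add: degree_monom_le)
    ultimately show "degree F = ?q"
      by (metis le_degree le_antisym zero_neq_one)
  qed
  have F_e: "poly F (e c) = 0" for c
    using e_power_card[of c 1] by (simp add: poly_F)
  have F_shift: "poly F (y + e c) = poly F y" for c
  proof -
    have "(\<Prod>b\<in>UNIV. y + e c - e b) = (\<Prod>b\<in>UNIV. y - e b)"
      by (rule prod.reindex_bij_witness[of _ "\<lambda>b. b + c" "\<lambda>b. b - c"])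
        (simp_all add: e_add e_diff algebra_simps)
    then show ?thesis
      by (simp only: poly_F power_card_minus_self_eq_prod)
  qed
  have "pcompose F [:y, 1:] = F + [:poly F y:]"
  proof (rule poly_eqI_degree_lead_coeff[where n = ?q and A = "range e"])
    have "lead_coeff (pcompose F [:y, 1:]) = 1"
      by (subst lead_coeff_comp) (simp_all add: deg_F lead_F)
    then show "coeff (pcompose F [:y, 1:]) ?q = coeff (F + [:poly F y:]) ?q"
      by (simp add: degree_pcompose deg_F lead_F coeff_pCons split: nat.splits)
    show "degree (F + [:poly F y:]) \<le> ?q"
      by (intro degree_add_le) (simp_all add: deg_F)
    show "poly (pcompose F [:y, 1:]) z = poly (F + [:poly F y:]) z" if "z \<in> range e" for z
      using that by (auto simp: poly_pcompose F_shift F_e)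
  qed (simp_all add: degree_pcompose deg_F card_image inj_e)
  then have "poly (pcompose F [:y, 1:]) x = poly (F + [:poly F y:]) x"
    by (rule arg_cong)
  then show ?thesis
    by (simp add: poly_pcompose poly_F algebra_simps)
qed

lemma frobenius_power_add:
  "(x + y :: 'c) ^ (CARD('fq) ^ n) = x ^ (CARD('fq) ^ n) + y ^ (CARD('fq) ^ n)"
  by (induction n) (simp_all add: power_mult mult.commute[of "CARD('fq)"] frobenius_add)

end


section \<open>Twisted polynomials as operators\<close>

definition tau_eval :: "nat \<Rightarrow> 'c::comm_semiring_1 poly \<Rightarrow> 'c \<Rightarrow> 'c"
  where "tau_eval q f x = (\<Sum>n\<le>degree f. coeff f n * x ^ (q ^ n))"

lemma tau_eval_eq_sum:
  assumes "degree f \<le> N"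
  shows "tau_eval q f x = (\<Sum>n\<le>N. coeff f n * x ^ (q ^ n))"
  unfolding tau_eval_def
  by (rule sum.mono_neutral_left) (use assms in \<open>auto simp: coeff_eq_0\<close>)

lemma tau_eval_0 [simp]: "tau_eval q 0 x = 0"
  by (simp add: tau_eval_def)

lemma tau_eval_add_left: "tau_eval q (f + g) x = tau_eval q f x + tau_eval q g x"
proof -
  let ?N = "max (degree f) (degree g)"
  have "degree (f + g) \<le> ?N" by (rule degree_add_le_max)
  then show ?thesis
    by (simp add: tau_eval_eq_sum[where N = ?N] sum.distrib distrib_right)
qed

lemma tau_eval_sum_left: "tau_eval q (sum f A) x = (\<Sum>a\<in>A. tau_eval q (f a) x)"
  by (induction A rule: infinite_finite_induct) (simp_all add: tau_eval_add_left)

lemma tau_eval_monom: "tau_eval q (monom c n) x = c * x ^ (q ^ n)"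
proof -
  have "tau_eval q (monom c n) x = (\<Sum>k\<le>n. coeff (monom c n) k * x ^ (q ^ k))"
    by (rule tau_eval_eq_sum) (rule degree_monom_le)
  also have "\<dots> = (\<Sum>k\<le>n. if k = n then c * x ^ (q ^ n) else 0)"
    by (rule sum.cong) auto
  finally show ?thesis by simp
qed

lemma tau_eval_smult_left:
  fixes c :: "'c::comm_semiring_1"
  shows "tau_eval q (smult c f) x = c * tau_eval q f x"
  by (subst tau_eval_eq_sum[where N = "degree f"])
    (simp_all add: degree_smult_le tau_eval_def sum_distrib_left mult.assoc)

lemma point_act_nth: "point_act q C P $ i = (\<Sum>j\<in>UNIV. tau_eval q (C $ i $ j) (P $ j))"
  by (simp add: point_act_def tau_eval_def)

lemma point_act_add_left: "point_act q (C + D) P = point_act q C P + point_act q D P"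
  by (simp add: vec_eq_iff point_act_nth tau_eval_add_left sum.distrib)

lemma point_act_mat_1: "point_act q (mat 1) P = P"
proof -
  have "tau_eval q (mat 1 $ i $ j) (P $ j) = (if i = j then P $ j else 0)" for i j
    by (simp add: mat_def) (simp add: tau_eval_def)
  then show ?thesis
    by (simp add: vec_eq_iff point_act_nth)
qed

lemma point_act_smult_left:
  fixes P :: "'c::comm_semiring_1 ^ 'd::finite"
  shows "point_act q (\<chi> i j. smult c (C $ i $ j)) P = c *s point_act q C P"
  by (simp add: vec_eq_iff point_act_nth tau_eval_smult_left sum_distrib_left)

context finite_field_embedding
begin

lemma frobenius_power_sum: "(sum u A :: 'c) ^ (CARD('fq) ^ n) = (\<Sum>a\<in>A. u a ^ (CARD('fq) ^ n))"
  by (induction A rule: infinite_finite_induct) (simp_all add: frobenius_power_add power_0_left)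

lemma tau_eval_add:
  "tau_eval CARD('fq) f (x + y) = tau_eval CARD('fq) f x + tau_eval CARD('fq) f (y :: 'c)"
  by (simp add: tau_eval_def frobenius_power_add distrib_left sum.distrib)

lemma tau_eval_zero [simp]: "tau_eval CARD('fq) f (0 :: 'c) = 0"
  by (simp add: tau_eval_def power_0_left)

lemma tau_eval_sum: "tau_eval CARD('fq) f (sum u A) = (\<Sum>a\<in>A. tau_eval CARD('fq) f (u a :: 'c))"
  by (induction A rule: infinite_finite_induct) (simp_all add: tau_eval_add)

text \<open>This is where the twisted multiplication comes from: \<open>(d x\<^bsup>q^j\<^esup>)\<^bsup>q^i\<^esup> = d\<^bsup>q^i\<^esup> x\<^bsup>q^(i+j)\<^esup>\<close>,
  and additivity of the Frobenius power map extends this from monomials to sums.\<close>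

lemma tau_eval_tau_mult:
  "tau_eval CARD('fq) (tau_mult CARD('fq) f g) x =
    tau_eval CARD('fq) f (tau_eval CARD('fq) g (x :: 'c))"
  by (simp add: tau_mult_def tau_eval_sum_left tau_eval_monom)
    (simp add: tau_eval_def frobenius_power_sum power_mult_distrib sum_distrib_left
      power_mult[symmetric] power_add mult_ac)

lemma point_act_add:
  "point_act CARD('fq) C (x + y) =
    point_act CARD('fq) C x + point_act CARD('fq) C (y :: 'c ^ 'd::finite)"
  by (simp add: vec_eq_iff point_act_nth tau_eval_add sum.distrib)

lemma point_act_tau_mat_mult:
  "point_act CARD('fq) (tau_mat_mult CARD('fq) A B) x =
    point_act CARD('fq) A (point_act CARD('fq) B (x :: 'c ^ 'd::finite))"
proof -
  have "(\<Sum>k\<in>UNIV. \<Sum>j\<in>UNIV. tau_eval CARD('fq) (A $ i $ j) (tau_eval CARD('fq) (B $ j $ k) (x $ k))) =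
      (\<Sum>j\<in>UNIV. \<Sum>k\<in>UNIV. tau_eval CARD('fq) (A $ i $ j) (tau_eval CARD('fq) (B $ j $ k) (x $ k)))" for i
    by (rule sum.swap)
  then show ?thesis
    by (simp add: vec_eq_iff point_act_nth tau_mat_mult_def tau_eval_sum_left tau_eval_tau_mult
        tau_eval_sum)
qed

lemma additive_point_act: "Modules.additive (point_act CARD('fq) C :: 'c ^ 'd::finite \<Rightarrow> 'c ^ 'd)"
  by standard (rule point_act_add)

lemma twist_mult: "twist CARD('fq) n (f * g) = twist CARD('fq) n f * twist CARD('fq) n (g :: 'c poly)"
  unfolding twist_def
  by (rule map_poly_mult_hom) (simp_all add: power_0_left frobenius_power_add power_mult_distrib)

lemma twist_add: "twist CARD('fq) n (f + g) = twist CARD('fq) n f + twist CARD('fq) n (g :: 'c poly)"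
  unfolding twist_def
  by (rule map_poly_add_hom) (simp_all add: power_0_left frobenius_power_add)

text \<open>Twisting fixes \<open>\<bbbF>\<^sub>q[t]\<close>, which is why the action on \<open>L[t]\<close>-vectors is \<open>\<bbbF>\<^sub>q[t]\<close>-linear.\<close>

lemma twist_map_poly_e: "twist CARD('fq) n (map_poly e b) = map_poly e b"
  unfolding twist_def by (rule poly_eqI) (simp add: coeff_map_poly power_0_left e_power_card)

lemma tau_act_add:
  "tau_act CARD('fq) A (x + y) =
    tau_act CARD('fq) A x + tau_act CARD('fq) A (y :: 'c poly ^ 'd::finite)"
  by (simp add: vec_eq_iff tau_act_def twist_add distrib_left sum.distrib)

lemma tau_act_scale:
  "tau_act CARD('fq) A (map_poly e b *s x) =
    map_poly e b *s tau_act CARD('fq) A (x :: 'c poly ^ 'd::finite)"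
  by (simp add: vec_eq_iff tau_act_def twist_mult twist_map_poly_e sum_distrib_left mult_ac)

end


section \<open>Comparing coefficients of powers of \<open>t\<close>\<close>

definition coeff_vec :: "'c::zero poly ^ 'd \<Rightarrow> nat \<Rightarrow> 'c ^ 'd"
  where "coeff_vec x n = (\<chi> j. coeff (x $ j) n)"

lemma coeff_vec_nth [simp]: "coeff_vec x n $ j = coeff (x $ j) n"
  by (simp add: coeff_vec_def)

lemma coeff_vec_eventually_0:
  fixes x :: "'c::zero poly ^ 'd::finite"
  obtains N where "\<And>n. n \<ge> N \<Longrightarrow> coeff_vec x n = 0"
proof
  fix n assume n: "n \<ge> Suc (Max (range (\<lambda>j. degree (x $ j))))"
  have "degree (x $ j) \<le> Max (range (\<lambda>j. degree (x $ j)))" for j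
    by (rule Max_ge) auto
  then have "degree (x $ j) < n" for j
    using n by (meson Suc_le_lessD le_less_trans)
  then show "coeff_vec x n = 0"
    by (simp add: vec_eq_iff coeff_eq_0)
qed

lemma coeff_vec_surj:
  fixes u :: "nat \<Rightarrow> 'c::zero ^ 'd::finite"
  assumes "\<And>n. n \<ge> N \<Longrightarrow> u n = 0"
  obtains x where "coeff_vec x = u"
proof
  have "coeff (Abs_poly (\<lambda>n. u n $ j)) = (\<lambda>n. u n $ j)" for j
    by (rule coeff_Abs_poly[where n = N]) (simp add: assms)
  then show "coeff_vec (\<chi> j. Abs_poly (\<lambda>n. u n $ j)) = u"
    by (simp add: fun_eq_iff vec_eq_iff)
qed

text \<open>
  The matrix of \<open>\<phi>\<^sub>t\<close> does not involve \<open>t\<close>, so it acts on each coefficient vector separately, while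
  multiplication by \<open>t\<close> shifts the coefficients.
\<close>

lemma coeff_tau_act_minus_t:
  fixes C :: "'c::field poly ^ 'd::finite ^ 'd"
  assumes "q > 0"
  shows "coeff_vec (tau_act q (tau_incl C - mat [:[:0, 1:]:]) x) n =
    point_act q C (coeff_vec x n) - coeff_vec (\<chi> j. pCons 0 (x $ j)) n"
proof -
  define op where "op A v = (\<Sum>n\<le>degree A. coeff A n * twist q n v)"
    for A :: "'c poly poly" and v :: "'c poly"
  \<comment> \<open>\<open>tau_act\<close> sums only up to the degree of an entry. A common upper bound for the degrees is what
    makes the action of a difference of entries comparable with the difference of the actions.\<close>
  have op_eq_sum: "op A v = (\<Sum>n\<le>N. coeff A n * twist q n v)" if "degree A \<le> N" for A v N
    unfolding op_def by (rule sum.mono_neutral_left) (use that in \<open>auto simp: coeff_eq_0\<close>)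
  have op_diff: "op (A - B) v = op A v - op B v" for A B v
  proof -
    let ?N = "max (degree A) (degree B)"
    have "degree (A - B) \<le> ?N" by (rule degree_diff_le_max)
    then show ?thesis
      by (simp add: op_eq_sum[where N = ?N] sum_subtractf left_diff_distrib)
  qed
  have coeff_op_const: "coeff (op (map_poly (\<lambda>c. [:c:]) f) v) n = tau_eval q f (coeff v n)" for f v
  proof -
    have "op (map_poly (\<lambda>c. [:c:]) f) v = (\<Sum>k\<le>degree f. [:coeff f k:] * twist q k v)"
      by (subst op_eq_sum[where N = "degree f"]) (simp_all add: degree_map_poly coeff_map_poly)
    then show ?thesis
      using assms by (simp add: coeff_sum tau_eval_def twist_def coeff_map_poly power_0_left)
  qed
  have op_mat: "op (mat [:[:0, 1:]:] $ i $ j) (x $ j) = (if i = j then pCons 0 (x $ j) else 0)"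
    for i j
    by (simp add: mat_def op_def twist_def)
  have tau_act_nth: "tau_act q A x $ i = (\<Sum>j\<in>UNIV. op (A $ i $ j) (x $ j))" for A i
    by (simp add: tau_act_def op_def)
  show ?thesis
    by (simp add: vec_eq_iff tau_act_nth op_diff op_mat sum_subtractf coeff_sum tau_incl_def
        coeff_op_const point_act_nth)
qed


section \<open>The recursion solved by the coefficients\<close>

text \<open>
  The difference \<open>p 0 - T (x 0)\<close> measures by how much the equation at \<open>t\<^sup>0\<close>, which the recursion leaves
  open, fails. For a sequence \<open>x\<close> with finite support, the last term vanishes once \<open>N\<close> is large.
\<close>

lemma telescoping_sum:
  fixes T :: "'a::ab_group_add \<Rightarrow> 'a"
  assumes "Modules.additive T" and step: "\<And>n. T (x (Suc n)) - x n = p (Suc n)"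
  shows "(\<Sum>n\<le>N. (T ^^ n) (p n)) = p 0 - T (x 0) + (T ^^ Suc N) (x N)"
proof (induction N)
  case (Suc N)
  have diff: "(T ^^ k) (u - v) = (T ^^ k) u - (T ^^ k) v" for k u v
    by (induction k) (simp_all add: additive.diff[OF assms(1)])
  have "(T ^^ Suc N) (p (Suc N)) = (T ^^ Suc N) (T (x (Suc N))) - (T ^^ Suc N) (x N)"
    by (simp only: step[symmetric] diff)
  moreover have "(T ^^ Suc N) (T (x (Suc N))) = (T ^^ Suc (Suc N)) (x (Suc N))"
    by (simp only: funpow_Suc_right o_apply)
  ultimately show ?case
    by (simp only: sum.atMost_Suc Suc) simp
qed simp

lemma backward_recursion_unique:
  assumes "\<And>n. T (x (Suc n)) - x n = p (Suc n)" "\<And>n. T (y (Suc n)) - y n = p (Suc n)"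
    and "\<And>n. n \<ge> N \<Longrightarrow> x n = (y n :: 'a::ab_group_add)"
  shows "x = y"
proof
  fix n
  have eq: "x n = T (x (Suc n)) - p (Suc n)" "y n = T (y (Suc n)) - p (Suc n)" for n
    by (simp add: assms(1)[symmetric], simp add: assms(2)[symmetric])
  show "x n = y n"
  proof (cases "n \<le> N")
    case True
    then show ?thesis
      by (induction rule: inc_induct) (simp add: assms(3), metis eq)
  qed (simp add: assms(3))
qed

text \<open>The set \<open>S\<close> carries the rationality of the solution: it will be \<open>L\<^sup>d\<close>, which \<open>T\<close> preserves.\<close>

lemma backward_recursion_exists:
  fixes T :: "'a::ab_group_add \<Rightarrow> 'a"
  assumes "Modules.additive T" and p: "\<And>n. n > N \<Longrightarrow> p n = 0"
    and S: "0 \<in> S" "\<And>u v. u \<in> S \<Longrightarrow> v \<in> S \<Longrightarrow> u - v \<in> S" "\<And>u. u \<in> S \<Longrightarrow> T u \<in> S" "\<And>n. p n \<in> S"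
  obtains x where "\<And>n. T (x (Suc n)) - x n = p (Suc n)" "\<And>n. n \<ge> N \<Longrightarrow> x n = 0" "\<And>n. x n \<in> S"
proof -
  \<comment> \<open>Reverse the index, \<open>y m = x (N - m)\<close>, to turn the recursion into a forward one. The truncated
    subtraction gives \<open>x n = y 0 = 0\<close> for \<open>n \<ge> N\<close>.\<close>
  define y where "y = rec_nat 0 (\<lambda>m u. T u - p (N - m))"
  have y: "y 0 = 0" "y (Suc m) = T (y m) - p (N - m)" for m
    by (simp_all add: y_def)
  have y_S: "y m \<in> S" for m
    by (induction m) (simp_all add: y S)
  show ?thesis
  proof (rule that[of "\<lambda>n. y (N - n)"])
    show "T (y (N - Suc n)) - y (N - n) = p (Suc n)" for n
    proof (cases "n < N")
      case True
      then obtain m where m: "N - n = Suc m" "N - Suc n = m" "N - m = Suc n"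
        by (metis Suc_diff_Suc diff_diff_cancel Suc_leI)
      show ?thesis by (simp add: m y)
    qed (simp add: y p additive.zero[OF assms(1)])
  qed (simp_all add: y y_S)
qed


section \<open>Solutions and relations of a t-module\<close>

locale t_module_points =
  fixes \<iota> :: "'fq::{field,finite} fls alg_closure \<Rightarrow> 'c::{field,complete_space}"
    and L :: "'c set"
    and \<phi> :: "'fq poly \<Rightarrow> 'c poly ^ 'd::finite ^ 'd"
    and P :: "'l::finite \<Rightarrow> 'c ^ 'd"
  assumes C_infty: "C_infty \<iota>"
    and global_function_field: "global_function_field \<iota> L"
    and t_module: "t_module \<iota> L \<phi>"
    and P_in_L: "P i $ j \<in> L"
begin

sublocale finite_field_embedding "Fq_emb \<iota>"
proof
  show "Fq_emb \<iota> 1 = 1"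
    using C_infty by (simp add: Fq_emb_def C_infty_def)
  show "Fq_emb \<iota> (x + y) = Fq_emb \<iota> x + Fq_emb \<iota> y" for x y
    using C_infty by (simp add: Fq_emb_def C_infty_def fls_plus_const[symmetric])
  show "Fq_emb \<iota> (x * y) = Fq_emb \<iota> x * Fq_emb \<iota> y" for x y
    using C_infty by (simp add: Fq_emb_def C_infty_def fls_const_mult_const[symmetric]
        del: fls_const_mult_const)
qed

lemma
  shows L_diff: "x \<in> L \<Longrightarrow> y \<in> L \<Longrightarrow> x - y \<in> L"
    and L_mult: "x \<in> L \<Longrightarrow> y \<in> L \<Longrightarrow> x * y \<in> L"
  using global_function_field by (auto simp: global_function_field_def)

lemma Fq_emb_in_L: "Fq_emb \<iota> c \<in> L"
proof -
  have "Fq_emb \<iota> c = poly (map_poly (Fq_emb \<iota>) [:c:]) (theta \<iota>) / poly (map_poly (Fq_emb \<iota>) 1) (theta \<iota>)"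
    by (simp add: map_poly_pCons e_one)
  then have "Fq_emb \<iota> c \<in> rational_field \<iota>"
    unfolding rational_field_def using one_neq_zero by blast
  then show ?thesis
    using global_function_field by (auto simp: global_function_field_def)
qed

lemma L_0: "0 \<in> L" and L_1: "1 \<in> L"
  using Fq_emb_in_L[of 0] Fq_emb_in_L[of 1] by (simp_all add: e_one)

lemma L_add: "x \<in> L \<Longrightarrow> y \<in> L \<Longrightarrow> x + y \<in> L"
  using L_diff[of x "0 - y"] L_diff[OF L_0, of y] by simp

lemma L_sum: "(\<And>a. a \<in> A \<Longrightarrow> u a \<in> L) \<Longrightarrow> sum u A \<in> L"
  by (induction A rule: infinite_finite_induct) (auto simp: L_0 L_add)

lemma L_power: "x \<in> L \<Longrightarrow> x ^ n \<in> L"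
  by (induction n) (auto simp: L_1 L_mult)

abbreviation T :: "'c ^ 'd \<Rightarrow> 'c ^ 'd"
  where "T \<equiv> point_act CARD('fq) (\<phi> [:0, 1:])"

lemma T_in_L: "(\<And>j. x $ j \<in> L) \<Longrightarrow> T x $ i \<in> L"
  using t_module
  by (auto simp: point_act_def t_module_def polys_over_def intro!: L_sum L_mult L_power)

text \<open>Horner's rule \<open>\<phi>\<^bsub>c + t a\<^esub> = c + \<phi>\<^sub>t \<phi>\<^sub>a\<close>, which lets properties of \<open>\<phi>\<^sub>a\<close> be proved by induction on \<open>a\<close>.\<close>

lemma point_act_pCons:
  "point_act CARD('fq) (\<phi> (pCons c a)) x = Fq_emb \<iota> c *s x + T (point_act CARD('fq) (\<phi> a) x)"
proof -
  have "pCons c a = smult c 1 + [:0, 1:] * a"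
    by (simp add: one_pCons)
  then have "\<phi> (pCons c a) =
      (\<chi> i j. smult (Fq_emb \<iota> c) (\<phi> 1 $ i $ j)) + tau_mat_mult CARD('fq) (\<phi> [:0, 1:]) (\<phi> a)"
    using t_module unfolding t_module_def by metis
  moreover have "\<phi> 1 = mat 1"
    using t_module by (simp add: t_module_def)
  ultimately show ?thesis
    by (simp only: point_act_add_left point_act_smult_left point_act_mat_1 point_act_tau_mat_mult)
qed

lemma point_act_0: "point_act CARD('fq) (\<phi> 0) x = 0"
proof -
  have "\<phi> (0 + 0) = \<phi> 0 + \<phi> 0"
    using t_module unfolding t_module_def by blast
  then have "\<phi> 0 = 0" by simp
  then show ?thesis by (simp add: vec_eq_iff point_act_nth)
qed

lemma point_act_eq_sum:
  assumes "degree a \<le> N"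
  shows "point_act CARD('fq) (\<phi> a) x = (\<Sum>n\<le>N. (T ^^ n) (Fq_emb \<iota> (coeff a n) *s x))"
  using assms
proof (induction a arbitrary: N)
  case 0
  have "(T ^^ n) 0 = 0" for n
    by (induction n) (simp_all add: additive.zero[OF additive_point_act])
  then show ?case by (simp add: point_act_0)
next
  case (pCons c a)
  have T_sum: "T (sum u A) = (\<Sum>n\<in>A. T (u n))" for u :: "nat \<Rightarrow> 'c ^ 'd" and A
    by (rule additive.sum[OF additive_point_act])
  show ?case
  proof (cases N)
    case 0
    with pCons have "a = 0" by (auto split: if_splits)
    then show ?thesis
      using 0 by (simp add: point_act_pCons[of c 0] point_act_0 additive.zero[OF additive_point_act])
  next
    case (Suc M)
    with pCons have "degree a \<le> M" by (auto split: if_splits)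
    then have "point_act CARD('fq) (\<phi> (pCons c a)) x =
        Fq_emb \<iota> c *s x + (\<Sum>n\<le>M. (T ^^ Suc n) (Fq_emb \<iota> (coeff a n) *s x))"
      by (simp add: point_act_pCons[of c a] pCons.IH T_sum)
    also have "\<dots> = (\<Sum>n\<le>Suc M. (T ^^ n) (Fq_emb \<iota> (coeff (pCons c a) n) *s x))"
      by (subst sum.atMost_Suc_shift) simp
    finally show ?thesis by (simp only: Suc)
  qed
qed

definition rhs_coeff :: "'fq poly ^ 'l \<Rightarrow> nat \<Rightarrow> 'c ^ 'd"
  where "rhs_coeff a n = (\<Sum>i\<in>UNIV. Fq_emb \<iota> (coeff (a $ i) n) *s P i)"

lemma rhs_coeff_eq:
  "coeff_vec (\<Sum>i\<in>UNIV. map_poly (Fq_emb \<iota>) (a $ i) *s (\<chi> j. [:P i $ j:])) n = rhs_coeff a n"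
  by (simp add: vec_eq_iff rhs_coeff_def coeff_sum coeff_map_poly mult.commute)

lemma rhs_coeff_in_L: "rhs_coeff a n $ j \<in> L"
  by (auto simp: rhs_coeff_def intro!: L_sum L_mult Fq_emb_in_L P_in_L)

lemma degree_bound:
  fixes a :: "'fq poly ^ 'l"
  obtains N where "\<And>i. degree (a $ i) \<le> N"
  by (rule that[of "Max (range (\<lambda>i. degree (a $ i)))"]) (rule Max_ge, auto)

lemma relation_module_iff:
  assumes "\<And>i. degree (a $ i) \<le> N"
  shows "a \<in> relation_module \<phi> P \<longleftrightarrow> (\<Sum>n\<le>N. (T ^^ n) (rhs_coeff a n)) = 0"
proof -
  have T_add: "(T ^^ n) (u + v) = (T ^^ n) u + (T ^^ n) v" for n u v
    by (induction n) (simp_all add: point_act_add)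
  have T_sum: "(T ^^ n) (sum u A) = (\<Sum>i\<in>A. (T ^^ n) (u i))" for n A and u :: "'l \<Rightarrow> 'c ^ 'd"
    by (rule additive.sum) (standard, rule T_add)
  have "(\<Sum>i\<in>UNIV. point_act CARD('fq) (\<phi> (a $ i)) (P i)) = (\<Sum>n\<le>N. (T ^^ n) (rhs_coeff a n))"
    by (simp add: point_act_eq_sum[OF assms] rhs_coeff_def T_sum) (rule sum.swap)
  then show ?thesis by (simp add: relation_module_def)
qed

lemma Sol_iff:
  "(x, a) \<in> Sol \<iota> L \<phi> P \<longleftrightarrow>
    (\<forall>n j. coeff_vec x n $ j \<in> L) \<and>
    T (coeff_vec x 0) = rhs_coeff a 0 \<and>
    (\<forall>n. T (coeff_vec x (Suc n)) - coeff_vec x n = rhs_coeff a (Suc n))"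
proof -
  have eq_iff: "u = v \<longleftrightarrow> (\<forall>n. coeff_vec u n = coeff_vec v n)" for u v :: "'c poly ^ 'd"
    by (auto simp: vec_eq_iff poly_eq_iff)
  have nat_iff: "(\<forall>n. Q n) \<longleftrightarrow> Q 0 \<and> (\<forall>n. Q (Suc n))" for Q :: "nat \<Rightarrow> bool"
    by (metis not0_implies_Suc)
  have shift: "coeff_vec (\<chi> j. pCons 0 (x $ j)) 0 = 0"
    "coeff_vec (\<chi> j. pCons 0 (x $ j)) (Suc n) = coeff_vec x n" for n
    by (simp_all add: vec_eq_iff)
  have "tau_act CARD('fq) (tau_incl (\<phi> [:0, 1:]) - mat [:[:0, 1:]:]) x =
        (\<Sum>i\<in>UNIV. map_poly (Fq_emb \<iota>) (a $ i) *s (\<chi> j. [:P i $ j:])) \<longleftrightarrow>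
      (\<forall>n. T (coeff_vec x n) - coeff_vec (\<chi> j. pCons 0 (x $ j)) n = rhs_coeff a n)"
    by (simp only: eq_iff rhs_coeff_eq coeff_tau_act_minus_t zero_less_card_finite)
  also have "\<dots> \<longleftrightarrow> T (coeff_vec x 0) = rhs_coeff a 0 \<and>
      (\<forall>n. T (coeff_vec x (Suc n)) - coeff_vec x n = rhs_coeff a (Suc n))"
    by (subst nat_iff) (simp only: shift diff_zero)
  finally show ?thesis
    by (auto simp: Sol_def polys_over_def)
qed

text \<open>Beyond the last nonzero coefficient of \<open>x\<close>, every term on the right of the telescoping formula
  cancels.\<close>

lemma Sol_in_relation_module:
  assumes "(x, a) \<in> Sol \<iota> L \<phi> P"
  shows "a \<in> relation_module \<phi> P"
proof -
  obtain N where N: "\<And>n. n \<ge> N \<Longrightarrow> coeff_vec x n = 0"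
    by (rule coeff_vec_eventually_0[of x]) blast
  obtain M where M: "\<And>i. degree (a $ i) \<le> M"
    by (rule degree_bound[of a]) blast
  have T_0: "(T ^^ n) 0 = 0" for n
    by (induction n) (simp_all add: additive.zero[OF additive_point_act])
  have "(\<Sum>n\<le>max M N. (T ^^ n) (rhs_coeff a n)) =
      rhs_coeff a 0 - T (coeff_vec x 0) + (T ^^ Suc (max M N)) (coeff_vec x (max M N))"
    by (rule telescoping_sum[where T = T and x = "coeff_vec x" and p = "rhs_coeff a",
          OF additive_point_act])
      (use assms in \<open>simp add: Sol_iff\<close>)
  also have "\<dots> = 0"
    using assms by (simp only: Sol_iff N max.cobounded2 T_0) simp
  finally show ?thesis
    by (subst relation_module_iff[of _ "max M N"]) (auto intro: le_trans[OF M])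
qed

lemma Sol_unique:
  assumes "(x, a) \<in> Sol \<iota> L \<phi> P" "(y, a) \<in> Sol \<iota> L \<phi> P"
  shows "x = y"
proof -
  obtain N where N: "\<And>n. n \<ge> N \<Longrightarrow> coeff_vec x n = 0"
    by (rule coeff_vec_eventually_0[of x]) blast
  obtain M where M: "\<And>n. n \<ge> M \<Longrightarrow> coeff_vec y n = 0"
    by (rule coeff_vec_eventually_0[of y]) blast
  have "coeff_vec x = coeff_vec y"
    by (rule backward_recursion_unique[where T = T and p = "rhs_coeff a" and N = "max M N"])
      (use assms in \<open>simp_all add: Sol_iff N M\<close>)
  then have "coeff (x $ j) n = coeff (y $ j) n" for j n
    by (metis coeff_vec_nth)
  then show ?thesis by (simp add: vec_eq_iff poly_eq_iff)
qed

text \<open>The backward recursion yields the coefficients; the telescoping formula then turns the relation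
  into the one equation, \<open>T x\<^sub>0 = p\<^sub>0\<close>, that the recursion leaves out.\<close>

lemma Sol_exists:
  assumes "a \<in> relation_module \<phi> P"
  shows "\<exists>x. (x, a) \<in> Sol \<iota> L \<phi> P"
proof -
  obtain N where N: "\<And>i. degree (a $ i) \<le> N"
    by (rule degree_bound[of a]) blast
  have rhs_0: "rhs_coeff a n = 0" if "n > N" for n
  proof -
    have "coeff (a $ i) n = 0" for i
      using that N[of i] by (intro coeff_eq_0) linarith
    then show ?thesis by (simp add: rhs_coeff_def)
  qed
  obtain u where step: "\<And>n. T (u (Suc n)) - u n = rhs_coeff a (Suc n)"
    and u_0: "\<And>n. n \<ge> N \<Longrightarrow> u n = 0" and u_L: "\<And>n. u n \<in> {v. \<forall>j. v $ j \<in> L}"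
    by (rule backward_recursion_exists[OF additive_point_act rhs_0, where S = "{v. \<forall>j. v $ j \<in> L}"])
      (auto simp: L_0 L_diff T_in_L rhs_coeff_in_L)
  obtain x where x: "coeff_vec x = u"
    by (rule coeff_vec_surj[OF u_0])
  have T_0: "(T ^^ n) 0 = 0" for n
    by (induction n) (simp_all add: additive.zero[OF additive_point_act])
  have "0 = (\<Sum>n\<le>N. (T ^^ n) (rhs_coeff a n))"
    using relation_module_iff[OF N] assms by simp
  also have "\<dots> = rhs_coeff a 0 - T (u 0) + (T ^^ Suc N) (u N)"
    by (rule telescoping_sum[where T = T and x = u and p = "rhs_coeff a",
          OF additive_point_act step])
  also have "\<dots> = rhs_coeff a 0 - T (u 0)"
    by (simp only: u_0 order_refl T_0 add_0_right)
  finally have "T (u 0) = rhs_coeff a 0" by simp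
  then have "(x, a) \<in> Sol \<iota> L \<phi> P"
    unfolding Sol_iff x using step u_L by auto
  then show ?thesis ..
qed

lemma image_snd_Sol: "snd ` Sol \<iota> L \<phi> P = relation_module \<phi> P"
  using Sol_in_relation_module Sol_exists by force

lemma module_pair_scale:
  "Modules.module (pair_scale \<iota> :: 'fq poly \<Rightarrow> ('c poly ^ 'd) \<times> ('fq poly ^ 'l) \<Rightarrow> _)"
  by standard
    (simp_all add: pair_scale_def prod_eq_iff vec_eq_iff map_poly_add_hom map_poly_mult_hom
      e_add e_mult e_one algebra_simps)

lemma Sol_add: "z \<in> Sol \<iota> L \<phi> P \<Longrightarrow> w \<in> Sol \<iota> L \<phi> P \<Longrightarrow> z + w \<in> Sol \<iota> L \<phi> P"
  by (auto simp: Sol_def polys_over_def L_add tau_act_add map_poly_add_hom e_add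
      vector_sadd_rdistrib sum.distrib)

lemma Sol_scale:
  assumes "z \<in> Sol \<iota> L \<phi> P"
  shows "pair_scale \<iota> b z \<in> Sol \<iota> L \<phi> P"
proof -
  have "coeff (map_poly (Fq_emb \<iota>) b * f) n \<in> L" if "\<And>n. coeff f n \<in> L" for f n
    using that by (auto simp: coeff_mult coeff_map_poly intro!: L_sum L_mult Fq_emb_in_L)
  then show ?thesis
    using assms
    by (auto simp: Sol_def pair_scale_def polys_over_def tau_act_scale map_poly_mult_hom e_add e_mult
        vec_eq_iff sum_distrib_left mult.assoc)
qed

lemma zero_in_Sol: "0 \<in> Sol \<iota> L \<phi> P"
  by (simp add: zero_prod_def Sol_iff rhs_coeff_def L_0 vec_eq_iff point_act_nth)

end

theorem theorem1p2p1:
  fixes \<iota> :: "'fq::{field,finite} fls alg_closure \<Rightarrow> 'c::{field,complete_space}"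
    and L :: "'c set"
    and \<phi> :: "'fq poly \<Rightarrow> 'c poly ^ 'd::finite ^ 'd"
    and P :: "'l::finite \<Rightarrow> 'c ^ 'd"
  assumes "C_infty \<iota>"
    and "global_function_field \<iota> L"
    and "t_module \<iota> L \<phi>"
    and "\<forall>i j. P i $ j \<in> L"
    and "Fq_lin_indep \<iota> P"
  shows "module_iso_on (pair_scale \<iota>) (*s) (Sol \<iota> L \<phi> P) (relation_module \<phi> P) (\<lambda>(x, a). a)"
proof -
  interpret t_module_points \<iota> L \<phi> P
    using assms by unfold_locales auto
  interpret pair: Modules.module "pair_scale \<iota> :: _ \<Rightarrow> ('c poly ^ 'd) \<times> ('fq poly ^ 'l) \<Rightarrow> _"
    by (rule module_pair_scale)
  interpret coord: Modules.module "(*s) :: 'fq poly \<Rightarrow> 'fq poly ^ 'l \<Rightarrow> _"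
    by standard (simp_all add: vec_eq_iff algebra_simps)
  interpret proj: Modules.module_hom "pair_scale \<iota>" "(*s)" "snd :: ('c poly ^ 'd) \<times> ('fq poly ^ 'l) \<Rightarrow> _"
    by standard (simp_all add: pair_scale_def)
  have Sol: "pair.subspace (Sol \<iota> L \<phi> P)"
    by (simp add: pair.subspace_def zero_in_Sol Sol_add Sol_scale)
  \<comment> \<open>That \<open>\<R>\<close> is a submodule comes for free, as it is the image of one under a linear map.\<close>
  have "coord.subspace (relation_module \<phi> P)"
    unfolding image_snd_Sol[symmetric] by (rule proj.subspace_image[OF Sol])
  moreover have "bij_betw snd (Sol \<iota> L \<phi> P) (relation_module \<phi> P)"
    unfolding bij_betw_def image_snd_Sol
    by (auto intro!: inj_onI dest: Sol_unique)
  moreover have "(\<lambda>(x, a). a) = (snd :: ('c poly ^ 'd) \<times> ('fq poly ^ 'l) \<Rightarrow> _)"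
    by auto
  ultimately show ?thesis
    using Sol image_snd_Sol pair.module_axioms coord.module_axioms
    by (auto simp: module_iso_on_def proj.add proj.scale bij_betw_def)
qed

end
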